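(* Let $G$ be a locally finite countable group with a proper left-invariant metric $d$. Then $(G,d)$ is bi-uniformly equivalent to a direct sum of cyclic groups $\bigoplus_{i=1}^\infty\mathbb{Z}_{a_i}$.
   Context: A group is locally finite if every finitely generated subgroup is finite. A left-invariant metric on a countable group is proper if every bounded subset is finite. Here $\mathbb{Z}_a$ is the cyclic group of finite order $a\ge1$, and $\bigoplus_{i=1}^\infty\mathbb{Z}_{a_i}$ is equipped with the metric $d_{\mathcal L}(x,y)=\min\{i\ge0\mid x^{-1}y\in G_i\}$ associated with the filtration $G_0=1$, $G_i=\mathbb{Z}_{a_1}\oplus\dots\oplus\mathbb{Z}_{a_i}$ by finite subgroups. Write $\mathbb{R}_+=[0,\infty)$. A map $f\colon X\to Y$ of metric spaces is uniform if there is a nondecreasing function $\delta_f\colon\mathbb{R}_+\to\mathbb{R}_+$ with $\lim_{t\to0}\delta_f(t)=0$ and $d_Y(f(x),f(x'))\le\delta_f(d_X(x,x'))$ for all $x,x'$. Two metric spaces are bi-uniformly equivalent if there is a bijection $f$ between them such that both $f$ and $f^{-1}$ are uniform. *)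

theory Defs
  imports "HOL-Algebra.Product_Groups" "HOL-Analysis.Abstract_Metric_Spaces"
begin

definition locally_finite_group :: "('a, 'b) monoid_scheme \<Rightarrow> bool" where
  "locally_finite_group G \<longleftrightarrow>
     group G \<and> (\<forall>A. A \<subseteq> carrier G \<longrightarrow> finite A \<longrightarrow> finite (generate G A))"

definition left_invariant :: "('a, 'b) monoid_scheme \<Rightarrow> ('a \<Rightarrow> 'a \<Rightarrow> real) \<Rightarrow> bool" where
  "left_invariant G d \<longleftrightarrow>
     (\<forall>g \<in> carrier G. \<forall>x \<in> carrier G. \<forall>y \<in> carrier G.
        d (g \<otimes>\<^bsub>G\<^esub> x) (g \<otimes>\<^bsub>G\<^esub> y) = d x y)"

definition proper_metric :: "'a set \<Rightarrow> ('a \<Rightarrow> 'a \<Rightarrow> real) \<Rightarrow> bool" where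
  "proper_metric X d \<longleftrightarrow> (\<forall>S. Metric_space.mbounded X d S \<longrightarrow> finite S)"

text \<open>The function \<open>\<delta>\<close> represents a map from the nonnegative reals to themselves;
  its values at negative arguments are irrelevant.\<close>

definition uniform_map ::
  "'a set \<Rightarrow> ('a \<Rightarrow> 'a \<Rightarrow> real) \<Rightarrow> 'b set \<Rightarrow> ('b \<Rightarrow> 'b \<Rightarrow> real) \<Rightarrow> ('a \<Rightarrow> 'b) \<Rightarrow> bool" where
  "uniform_map X dX Y dY f \<longleftrightarrow>
     f \<in> X \<rightarrow> Y \<and>
     (\<exists>\<delta>. \<delta> \<in> {0..} \<rightarrow> {0..} \<and> mono_on {0..} \<delta> \<and>
          (\<delta> \<longlongrightarrow> (0::real)) (at (0::real) within {0..}) \<and>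
          (\<forall>x \<in> X. \<forall>x' \<in> X. dY (f x) (f x') \<le> \<delta> (dX x x')))"

definition bi_uniformly_equivalent ::
  "'a set \<Rightarrow> ('a \<Rightarrow> 'a \<Rightarrow> real) \<Rightarrow> 'b set \<Rightarrow> ('b \<Rightarrow> 'b \<Rightarrow> real) \<Rightarrow> bool" where
  "bi_uniformly_equivalent X dX Y dY \<longleftrightarrow>
     (\<exists>f. bij_betw f X Y \<and> uniform_map X dX Y dY f \<and> uniform_map Y dY X dX (inv_into X f))"

text \<open>The sequence \<open>a\<close> is indexed from 1; the value \<open>a 0\<close> is not used.
  Note that \<^const>\<open>integer_mod_group\<close> is infinite cyclic at \<open>0\<close>, so finiteness of the
  summands requires the entries of \<open>a\<close> to be positive.\<close>

definition cyclic_sum :: "(nat \<Rightarrow> nat) \<Rightarrow> (nat \<Rightarrow> int) monoid" where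
  "cyclic_sum a = sum_group {1..} (\<lambda>i. integer_mod_group (a i))"

text \<open>The subgroup of the first \<open>i\<close> summands, as an internal direct sum.\<close>

definition cyclic_sum_filtration :: "(nat \<Rightarrow> nat) \<Rightarrow> nat \<Rightarrow> (nat \<Rightarrow> int) set" where
  "cyclic_sum_filtration a i =
     {x \<in> carrier (cyclic_sum a). \<forall>j > i. x j = \<one>\<^bsub>integer_mod_group (a j)\<^esub>}"

definition cyclic_sum_dist :: "(nat \<Rightarrow> nat) \<Rightarrow> (nat \<Rightarrow> int) \<Rightarrow> (nat \<Rightarrow> int) \<Rightarrow> real" where
  "cyclic_sum_dist a x y =
     real (LEAST i. inv\<^bsub>cyclic_sum a\<^esub> x \<otimes>\<^bsub>cyclic_sum a\<^esub> y \<in> cyclic_sum_filtration a i)"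

end

theory Submission
  imports Defs
begin

text \<open>Let \<open>H i\<close> be the finite subgroup generated by the ball of radius \<open>i\<close> around the identity;
  \<open>H 0\<close> is trivial and the \<open>H i\<close> exhaust \<open>G\<close>. Inside each left coset of \<open>H i\<close>, number the left
  cosets of \<open>H (i-1)\<close>, giving number 0 to \<open>H (i-1)\<close> itself. Sending \<open>x\<close> to the sequence of the
  numbers of the cosets that contain it is an isometry from \<open>G\<close>, with the ultrametric of the
  filtration \<open>H\<close>, onto the direct sum of the cyclic groups of orders \<open>[H i : H (i-1)]\<close>. By
  left invariance and properness, this ultrametric and \<open>d\<close> bound each other on every scale, and both
  are bounded away from 0 off the diagonal.\<close>

section \<open>Uniformity from bounds at integer scales\<close>

text \<open>A modulus that vanishes on \<open>[0, e)\<close> tends to 0 at 0 for trivial reasons, so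
  at larger distances any bound, however crude, is enough.\<close>

lemma uniform_map_of_discrete:
  fixes B :: "nat \<Rightarrow> real"
  assumes f: "f \<in> X \<rightarrow> Y" and "0 < e"
    and zero: "\<And>x x'. x \<in> X \<Longrightarrow> x' \<in> X \<Longrightarrow> dX x x' < e \<Longrightarrow> dY (f x) (f x') \<le> 0"
    and bound: "\<And>n x x'. x \<in> X \<Longrightarrow> x' \<in> X \<Longrightarrow> dX x x' \<le> real n \<Longrightarrow> dY (f x) (f x') \<le> B n"
  shows "uniform_map X dX Y dY f"
proof -
  \<comment> \<open>Summing absolute values makes \<open>\<delta>\<close> nonnegative and
    nondecreasing for an arbitrary \<open>B\<close>; rounding up reduces real distances to integer
    scales.\<close>
  define \<delta> where "\<delta> t = (if t < e then 0 else \<Sum>i\<le>nat \<lceil>t\<rceil>. \<bar>B i\<bar>)" for t :: real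
  have "\<delta> \<in> {0..} \<rightarrow> {0..}"
    by (auto simp: \<delta>_def intro!: sum_nonneg)
  moreover have "mono_on {0..} \<delta>"
  proof (rule mono_onI)
    fix r s :: real assume "r \<in> {0..}" "s \<in> {0..}" "r \<le> s"
    then have "nat \<lceil>r\<rceil> \<le> nat \<lceil>s\<rceil>" by (intro nat_mono ceiling_mono)
    then have "(\<Sum>i\<le>nat \<lceil>r\<rceil>. \<bar>B i\<bar>) \<le> (\<Sum>i\<le>nat \<lceil>s\<rceil>. \<bar>B i\<bar>)"
      by (intro sum_mono2) auto
    with \<open>r \<le> s\<close> show "\<delta> r \<le> \<delta> s"
      by (auto simp: \<delta>_def intro!: sum_nonneg)
  qed
  moreover have "(\<delta> \<longlongrightarrow> 0) (at 0 within {0..})"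
  proof (rule tendsto_eventually)
    show "\<forall>\<^sub>F t in at 0 within {0..}. \<delta> t = 0"
      unfolding eventually_at using \<open>0 < e\<close> by (auto simp: \<delta>_def dist_real_def)
  qed
  moreover have "dY (f x) (f x') \<le> \<delta> (dX x x')" if x: "x \<in> X" "x' \<in> X" for x x'
  proof (cases "dX x x' < e")
    case True
    then show ?thesis using zero[OF x] by (simp add: \<delta>_def)
  next
    case False
    let ?n = "nat \<lceil>dX x x'\<rceil>"
    have "dY (f x) (f x') \<le> B ?n"
      using bound[OF x real_nat_ceiling_ge] .
    also have "\<dots> \<le> \<bar>B ?n\<bar>" by simp
    also have "\<dots> \<le> (\<Sum>i\<le>?n. \<bar>B i\<bar>)"
      by (rule member_le_sum) auto
    finally show ?thesis using False by (simp add: \<delta>_def)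
  qed
  ultimately show ?thesis
    unfolding uniform_map_def using f by blast
qed

section \<open>Numbering cosets\<close>

text \<open>The number 0 is reserved for a chosen point because the trivial coset must receive the
  identity of the cyclic summand; this is what gives the sequences finite support.\<close>

lemma ex_bij_betw_finite_nat_pointed:
  assumes "finite Q" "c \<in> Q"
  shows "\<exists>b. bij_betw b Q {0..<card Q} \<and> b c = 0"
proof -
  obtain b where b: "bij_betw b (Q - {c}) {1..<card Q}"
    using finite_same_card_bij[of "Q - {c}" "{1..<card Q}"] assms by auto
  have "bij_betw (b(c := 0)) (Q - {c}) {1..<card Q}"
    using b by (subst bij_betw_cong[of _ _ b]) auto
  then have "bij_betw (b(c := 0)) (Q - {c} \<union> {c}) ({1..<card Q} \<union> {(b(c := 0)) c})"
    by (intro notIn_Un_bij_betw) auto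
  moreover have "Q - {c} \<union> {c} = Q" using assms by auto
  moreover have "{1..<card Q} \<union> {(b(c := 0)) c} = {0..<card Q}"
    using assms card_gt_0_iff[of Q] by auto
  ultimately have "bij_betw (b(c := 0)) Q {0..<card Q}" by simp
  then show ?thesis by (intro exI[of _ "b(c := 0)"]) simp
qed

text \<open>The numbering of the cosets of \<open>K\<close> in \<open>H\<close> is translated to the other cosets of \<open>H\<close> by chosen
  representatives.\<close>

lemma (in group) ex_coset_numbering:
  assumes H: "subgroup H G" and K: "subgroup K G" and "K \<subseteq> H" "finite H"
  shows "\<exists>(n::nat) \<phi>. (\<forall>x\<in>carrier G. \<phi> x < n) \<and> (\<forall>x\<in>K. \<phi> x = 0) \<and>
    (\<forall>x\<in>carrier G. \<forall>y\<in>carrier G. inv x \<otimes> y \<in> H \<longrightarrow> (\<phi> x = \<phi> y \<longleftrightarrow> inv x \<otimes> y \<in> K)) \<and>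
    (\<forall>x\<in>carrier G. \<forall>m<n. \<exists>y\<in>carrier G. inv x \<otimes> y \<in> H \<and> \<phi> y = m)"
proof -
  interpret H: subgroup H G by fact
  interpret K: subgroup K G by fact
  have eqH: "equiv (carrier G) (rcong H)" and eqK: "equiv (carrier G) (rcong K)"
    by (auto intro: H.equiv_rcong K.equiv_rcong is_group)
  \<comment> \<open>The \<open>rcong H\<close> class of \<open>x\<close> is the left coset
    \<open>x H\<close>, and \<open>\<rho> x\<close> is its representative. Choosing
    \<open>\<one>\<close> for \<open>H\<close> itself makes \<open>\<tau>\<close> the identity on
    \<open>H\<close>. In general \<open>\<tau> x\<close> is the position of \<open>x\<close>
    relative to \<open>\<rho> x\<close>, and \<open>q x\<close> is the left coset
    \<open>x K\<close>.\<close>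
  define \<rho> where "\<rho> x = (if x \<in> H then \<one> else SOME z. z \<in> rcong H `` {x})" for x
  define \<tau> where "\<tau> x = inv \<rho> x \<otimes> x" for x
  define q where "q x = rcong K `` {x}" for x
  have q_eq: "q x = q y \<longleftrightarrow> inv x \<otimes> y \<in> K" if "x \<in> carrier G" "y \<in> carrier G" for x y
    using eq_equiv_class_iff[OF eqK that] that by (simp add: q_def r_congruent_def)
  have \<rho>: "\<rho> x \<in> carrier G" "inv x \<otimes> \<rho> x \<in> H" if x: "x \<in> carrier G" for x
  proof -
    have "x \<in> rcong H `` {x}" using equiv_class_self[OF eqH x] .
    then have "(SOME z. z \<in> rcong H `` {x}) \<in> rcong H `` {x}" by (rule someI)
    then show "\<rho> x \<in> carrier G" "inv x \<otimes> \<rho> x \<in> H"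
      by (auto simp: \<rho>_def r_congruent_def)
  qed
  have \<rho>_eq: "\<rho> x = \<rho> y" if x: "x \<in> carrier G" "y \<in> carrier G" "inv x \<otimes> y \<in> H" for x y
  proof -
    have "rcong H `` {x} = rcong H `` {y}"
      using eq_equiv_class_iff[OF eqH x(1,2)] x by (simp add: r_congruent_def)
    \<comment> \<open>Equal classes settle the \<open>SOME\<close> branch of \<open>\<rho>\<close>;
      it remains to see that \<open>x\<close> and \<open>y\<close> fall into the same
      branch.\<close>
    moreover have "x \<in> H \<longleftrightarrow> y \<in> H"
    proof
      assume "x \<in> H"
      then have "x \<otimes> (inv x \<otimes> y) \<in> H" using x(3) by blast
      then show "y \<in> H" using x by (simp add: m_assoc[symmetric])
    next
      assume "y \<in> H"
      then have "y \<otimes> inv (inv x \<otimes> y) \<in> H" using x(3) by blast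
      then show "x \<in> H" using x by (simp add: inv_mult_group m_assoc[symmetric])
    qed
    ultimately show ?thesis by (simp add: \<rho>_def)
  qed
  have \<tau>: "\<tau> x \<in> H" if x: "x \<in> carrier G" for x
  proof -
    have "inv (inv x \<otimes> \<rho> x) \<in> H" using \<rho>(2)[OF x] by blast
    then show ?thesis using x \<rho>(1)[OF x] by (simp add: \<tau>_def inv_mult_group)
  qed
  define Q where "Q = q ` H"
  have "finite Q" "q \<one> \<in> Q" using \<open>finite H\<close> by (auto simp: Q_def)
  then obtain b where b: "bij_betw b Q {0..<card Q}" "b (q \<one>) = 0"
    using ex_bij_betw_finite_nat_pointed by metis
  define \<phi> where "\<phi> x = b (q (\<tau> x))" for x
  have qQ: "q (\<tau> x) \<in> Q" if "x \<in> carrier G" for x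
    using \<tau>[OF that] by (simp add: Q_def)
  have "\<phi> x < card Q" if "x \<in> carrier G" for x
    using bij_betwE[OF b(1)] qQ[OF that] by (auto simp: \<phi>_def)
  moreover have "\<phi> x = 0" if "x \<in> K" for x
  proof -
    have "x \<in> H" "x \<in> carrier G" using that \<open>K \<subseteq> H\<close> by auto
    moreover from this have "q x = q \<one>" using that by (subst q_eq) auto
    ultimately show ?thesis using b(2) by (simp add: \<phi>_def \<tau>_def \<rho>_def)
  qed
  moreover have "\<phi> x = \<phi> y \<longleftrightarrow> inv x \<otimes> y \<in> K"
    if x: "x \<in> carrier G" "y \<in> carrier G" and xy: "inv x \<otimes> y \<in> H" for x y
  proof -
    have "\<phi> x = \<phi> y \<longleftrightarrow> q (\<tau> x) = q (\<tau> y)"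
      using b(1) qQ x by (auto simp: \<phi>_def bij_betw_def inj_on_def)
    also have "\<dots> \<longleftrightarrow> inv (\<tau> x) \<otimes> \<tau> y \<in> K"
      using \<tau> x H.subset by (intro q_eq) auto
    \<comment> \<open>The common representative of \<open>x\<close> and \<open>y\<close> cancels.
      \<open>r_inv\<close> is withheld so that both sides reach the same normal form; the next step
      applies it.\<close>
    also have "inv (\<tau> x) \<otimes> \<tau> y = inv x \<otimes> (\<rho> x \<otimes> inv \<rho> x) \<otimes> y"
      using x \<rho>(1)[OF x(1)] \<rho>_eq[OF x xy, symmetric]
      by (simp add: \<tau>_def inv_mult_group m_assoc del: r_inv Units_r_inv)
    also have "\<dots> = inv x \<otimes> y" using x \<rho>(1)[OF x(1)] by simp
    finally show ?thesis .
  qed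
  moreover have "\<exists>y\<in>carrier G. inv x \<otimes> y \<in> H \<and> \<phi> y = m"
    if x: "x \<in> carrier G" and m: "m < card Q" for x m
  proof -
    have "m \<in> b ` Q" using b(1) m by (simp add: bij_betw_def)
    then obtain h where h: "h \<in> H" "b (q h) = m" by (auto simp: Q_def)
    have hG: "h \<in> carrier G" using h by auto
    \<comment> \<open>This is the element at position \<open>h\<close> in the coset of
      \<open>x\<close>: it has the representative \<open>\<rho> x\<close>, so
      \<open>\<tau> y = h\<close>.\<close>
    define y where "y = \<rho> x \<otimes> h"
    have y: "y \<in> carrier G" using \<rho>(1)[OF x] h by (simp add: y_def)
    have "inv x \<otimes> y = (inv x \<otimes> \<rho> x) \<otimes> h"
      using x \<rho>(1)[OF x] hG by (simp add: y_def m_assoc)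
    then have xy: "inv x \<otimes> y \<in> H" using \<rho>(2)[OF x] h by simp
    have "\<tau> y = inv \<rho> x \<otimes> (\<rho> x \<otimes> h)"
      unfolding \<tau>_def \<rho>_eq[OF x y xy, symmetric] by (simp add: y_def)
    then have "\<tau> y = h"
      using \<rho>(1)[OF x] hG by (simp add: m_assoc[symmetric])
    then show ?thesis using y xy h by (auto simp: \<phi>_def)
  qed
  ultimately show ?thesis by (intro exI[of _ "card Q"] exI[of _ \<phi>]) blast
qed

section \<open>The direct sum in coordinates\<close>

lemma carrier_cyclic_sum:
  assumes "\<forall>i\<ge>1. a i \<ge> 1"
  shows "carrier (cyclic_sum a) =
    {x \<in> \<Pi>\<^sub>E i\<in>{1..}. {0..<int (a i)}. finite {i \<in> {1..}. x i \<noteq> 0}}"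
proof -
  have "(\<Pi>\<^sub>E i\<in>{1..}. carrier (integer_mod_group (a i))) = (\<Pi>\<^sub>E i\<in>{1..}. {0..<int (a i)})"
    using assms by (intro PiE_cong) (auto simp: carrier_integer_mod_group)
  then show ?thesis by (simp add: cyclic_sum_def carrier_sum_group)
qed

text \<open>Group operations act coordinatewise, so the metric of the direct sum depends only on the
  index beyond which two sequences agree.\<close>

lemma cyclic_sum_filtration_iff:
  assumes "x \<in> carrier (cyclic_sum a)" "y \<in> carrier (cyclic_sum a)"
  shows "inv\<^bsub>cyclic_sum a\<^esub> x \<otimes>\<^bsub>cyclic_sum a\<^esub> y \<in> cyclic_sum_filtration a i \<longleftrightarrow> (\<forall>j>i. x j = y j)"
proof -
  have grp: "group (cyclic_sum a)" by (simp add: cyclic_sum_def)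
  then have mem: "inv\<^bsub>cyclic_sum a\<^esub> x \<otimes>\<^bsub>cyclic_sum a\<^esub> y \<in> carrier (cyclic_sum a)"
    using assms by (intro monoid.m_closed group.is_monoid group.inv_closed)
  have "(inv\<^bsub>cyclic_sum a\<^esub> x \<otimes>\<^bsub>cyclic_sum a\<^esub> y) j = \<one>\<^bsub>integer_mod_group (a j)\<^esub> \<longleftrightarrow> x j = y j"
    if "j > i" for j
  proof -
    have j: "j \<ge> 1" using that by simp
    interpret Z: group "integer_mod_group (a j)" by simp
    have xj: "x j \<in> carrier (integer_mod_group (a j))" "y j \<in> carrier (integer_mod_group (a j))"
      using assms j by (auto simp: cyclic_sum_def carrier_sum_group PiE_iff)
    have "(inv\<^bsub>cyclic_sum a\<^esub> x \<otimes>\<^bsub>cyclic_sum a\<^esub> y) j =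
        inv\<^bsub>integer_mod_group (a j)\<^esub> x j \<otimes>\<^bsub>integer_mod_group (a j)\<^esub> y j"
      using assms j by (simp add: cyclic_sum_def del: inv_integer_mod_group mult_integer_mod_group)
    also have "\<dots> = \<one>\<^bsub>integer_mod_group (a j)\<^esub> \<longleftrightarrow> x j = y j"
      using Z.inv_solve_left'[OF Z.one_closed xj] Z.r_one[OF xj(1)] by metis
    finally show ?thesis .
  qed
  then show ?thesis using mem by (simp add: cyclic_sum_filtration_def)
qed

section \<open>The isometry onto the direct sum\<close>

text \<open>The bijection need not be a homomorphism: distances match as soon as agreement of all
  coordinates beyond \<open>i\<close> means lying in the same left coset of
  \<open>H i\<close>.\<close>

lemma (in group) ex_isometry_cyclic_sum:
  fixes H :: "nat \<Rightarrow> 'a set"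
  assumes sub: "\<And>i. subgroup (H i) G" and "mono H" and fin: "\<And>i. finite (H i)"
    and H0: "H 0 = {\<one>}" and UH: "(\<Union>i. H i) = carrier G"
  shows "\<exists>a f. (\<forall>i\<ge>1. a i \<ge> 1) \<and> bij_betw f (carrier G) (carrier (cyclic_sum a)) \<and>
    (\<forall>x\<in>carrier G. \<forall>y\<in>carrier G.
      cyclic_sum_dist a (f x) (f y) = real (LEAST i. inv x \<otimes> y \<in> H i))"
proof -
  have mono: "H i \<subseteq> H j" if "i \<le> j" for i j
    using monoD[OF \<open>mono H\<close> that] .
  then have memI: "x \<in> H j" if "x \<in> H i" "i \<le> j" for x i j
    using that by blast
  \<comment> \<open>\<open>N\<close> packages the conclusion of \<open>ex_coset_numbering\<close>
    for \<open>H (i - 1)\<close> inside \<open>H i\<close>, ready for two applications of choice. At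
    \<open>i = 0\<close> truncated subtraction gives the pair \<open>H 0\<close>,
    \<open>H 0\<close>.\<close>
  define N where "N i n \<phi> \<longleftrightarrow> (\<forall>x\<in>carrier G. \<phi> x < (n::nat)) \<and> (\<forall>x\<in>H (i - 1). \<phi> x = 0) \<and>
    (\<forall>x\<in>carrier G. \<forall>y\<in>carrier G. inv x \<otimes> y \<in> H i \<longrightarrow> (\<phi> x = \<phi> y \<longleftrightarrow> inv x \<otimes> y \<in> H (i - 1))) \<and>
    (\<forall>x\<in>carrier G. \<forall>m<n. \<exists>y\<in>carrier G. inv x \<otimes> y \<in> H i \<and> \<phi> y = m)" for i n \<phi>
  have "\<forall>i. \<exists>n \<phi>. N i n \<phi>"
    unfolding N_def by (intro allI ex_coset_numbering sub fin mono) simp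
  then obtain a where "\<forall>i. \<exists>\<phi>. N i (a i) \<phi>"
    by (rule choice[THEN exE])
  then obtain \<phi> where N: "\<forall>i. N i (a i) (\<phi> i)"
    by (rule choice[THEN exE])
  have lt: "\<phi> i x < a i" if "x \<in> carrier G" for i x
    using N that unfolding N_def by blast
  have zero: "\<phi> i x = 0" if "x \<in> H (i - 1)" for i x
    using N that unfolding N_def by blast
  have eq: "\<phi> i x = \<phi> i y \<longleftrightarrow> inv x \<otimes> y \<in> H (i - 1)"
    if "x \<in> carrier G" "y \<in> carrier G" "inv x \<otimes> y \<in> H i" for i x y
    using N that unfolding N_def by blast
  have ex: "\<exists>y\<in>carrier G. inv x \<otimes> y \<in> H i \<and> \<phi> i y = m"
    if "x \<in> carrier G" "m < a i" for i x m
    using N that unfolding N_def by blast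
  have a: "\<forall>i\<ge>1. a i \<ge> 1"
    using lt[OF one_closed] by (metis One_nat_def Suc_leI gr_zeroI not_less_zero)
  have key: "inv x \<otimes> y \<in> H i \<longleftrightarrow> (\<forall>j>i. \<phi> j x = \<phi> j y)"
    if x: "x \<in> carrier G" "y \<in> carrier G" for x y i
  proof
    assume xy: "inv x \<otimes> y \<in> H i"
    show "\<forall>j>i. \<phi> j x = \<phi> j y"
    proof (intro allI impI)
      fix j assume "j > i"
      then have "inv x \<otimes> y \<in> H (j - 1)" "inv x \<otimes> y \<in> H j"
        by (auto intro: memI[OF xy])
      then show "\<phi> j x = \<phi> j y" using eq[OF x] by blast
    qed
  next
    assume *: "\<forall>j>i. \<phi> j x = \<phi> j y"
    have "inv x \<otimes> y \<in> carrier G" using x by simp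
    then obtain m where "inv x \<otimes> y \<in> H m" using UH by blast
    \<comment> \<open>Exhaustion gives a starting level, taken at least \<open>i\<close>; agreement
      at coordinate \<open>n + 1\<close> then lowers membership from \<open>H (Suc n)\<close> to
      \<open>H n\<close>, down to \<open>i\<close>.\<close>
    then have m: "inv x \<otimes> y \<in> H (max m i)" by (rule memI) simp
    show "inv x \<otimes> y \<in> H i"
    proof (rule inc_induct[of i "max m i"])
      fix n assume "i \<le> n" "inv x \<otimes> y \<in> H (Suc n)"
      then show "inv x \<otimes> y \<in> H n" using eq[OF x, of "Suc n"] * by simp
    qed (use m in auto)
  qed
  \<comment> \<open>Coordinates are prescribed from the top down: \<open>z\<close> fixes coordinate
    \<open>n + 1\<close> within the coset \<open>y H (n + 1)\<close>, and the induction continues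
    inside \<open>z H n\<close>, where that coordinate is constant. Hence the base point
    \<open>y\<close> must vary.\<close>
  have surj: "\<exists>x\<in>carrier G. inv y \<otimes> x \<in> H n \<and> (\<forall>j\<in>{1..n}. \<phi> j x = k j)"
    if k: "\<And>j. j \<ge> 1 \<Longrightarrow> k j < a j" and y: "y \<in> carrier G" for k n y
    using y
  proof (induction n arbitrary: y)
    case 0
    then show ?case by (auto simp: H0)
  next
    case (Suc n)
    obtain z where z: "z \<in> carrier G" "inv y \<otimes> z \<in> H (Suc n)" "\<phi> (Suc n) z = k (Suc n)"
      using ex[OF Suc.prems k[of "Suc n"]] by auto
    obtain x where x: "x \<in> carrier G" "inv z \<otimes> x \<in> H n" "\<forall>j\<in>{1..n}. \<phi> j x = k j"
      using Suc.IH[OF z(1)] by blast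
    have "\<phi> (Suc n) x = \<phi> (Suc n) z"
      using key[OF z(1) x(1), of n] x(2) by simp
    moreover have "inv y \<otimes> x \<in> H (Suc n)"
      using key[OF Suc.prems z(1), of "Suc n"] key[OF z(1) x(1), of n]
        key[OF Suc.prems x(1), of "Suc n"] z x by simp
    ultimately show ?case
      using x z by (intro bexI[of _ x]) (auto simp: le_Suc_eq)
  qed
  define f where "f x = (\<lambda>i\<in>{1..}. int (\<phi> i x))" for x
  have f_eq: "(\<forall>j>i. f x j = f y j) \<longleftrightarrow> inv x \<otimes> y \<in> H i"
    if "x \<in> carrier G" "y \<in> carrier G" for x y i
    by (simp add: key[OF that] f_def)
  have fmem: "f x \<in> carrier (cyclic_sum a)" if x: "x \<in> carrier G" for x
  proof -
    obtain m where m: "x \<in> H m" using x UH by blast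
    \<comment> \<open>For \<open>i > m\<close> the element \<open>x\<close> lies in
      \<open>H (i - 1)\<close>, which is numbered 0.\<close>
    have "{i \<in> {1..}. f x i \<noteq> 0} \<subseteq> {..m}"
    proof
      fix i assume i: "i \<in> {i \<in> {1..}. f x i \<noteq> 0}"
      show "i \<in> {..m}"
      proof (rule ccontr)
        assume "i \<notin> {..m}"
        then have "x \<in> H (i - 1)" by (intro memI[OF m]) auto
        then show False using zero[of x i] i by (auto simp: f_def)
      qed
    qed
    then have "finite {i \<in> {1..}. f x i \<noteq> 0}" by (rule finite_subset) simp
    then show ?thesis
      using lt[OF x] by (simp add: carrier_cyclic_sum[OF a] f_def)
  qed
  have "bij_betw f (carrier G) (carrier (cyclic_sum a))"
    unfolding bij_betw_def
  proof (intro conjI equalityI subsetI)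
    show "inj_on f (carrier G)"
    proof (rule inj_onI)
      fix x y assume x: "x \<in> carrier G" "y \<in> carrier G" and "f x = f y"
      then have "inv x \<otimes> y = \<one>" using f_eq[OF x, of 0] H0 by simp
      then show "x = y" using x by (metis inv_equality inv_inv inv_closed inv_comm)
    qed
  next
    fix k assume "k \<in> carrier (cyclic_sum a)"
    then have k: "k \<in> (\<Pi>\<^sub>E i\<in>{1..}. {0..<int (a i)})" and "finite {i \<in> {1..}. k i \<noteq> 0}"
      by (auto simp: carrier_cyclic_sum[OF a])
    then obtain n where n: "\<And>i. i \<ge> 1 \<Longrightarrow> k i \<noteq> 0 \<Longrightarrow> i \<le> n"
      using finite_nat_set_iff_bounded_le[of "{i \<in> {1..}. k i \<noteq> 0}"] by auto
    have kr: "0 \<le> k j \<and> k j < int (a j)" if "j \<ge> 1" for j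
      using k that by (auto simp: PiE_iff)
    then have "nat (k j) < a j" if "j \<ge> 1" for j
      using that by fastforce
    \<comment> \<open>Starting from \<open>\<one>\<close> puts \<open>x\<close> into
      \<open>H n\<close>, so its coordinates beyond \<open>n\<close> are 0, like those of
      \<open>k\<close>.\<close>
    then obtain x where x: "x \<in> carrier G" "inv \<one> \<otimes> x \<in> H n" "\<forall>j\<in>{1..n}. \<phi> j x = nat (k j)"
      using surj[of "\<lambda>j. nat (k j)" \<one> n] by auto
    have "f x i = k i" for i
    proof -
      consider "i = 0" | "1 \<le> i" "i \<le> n" | "n < i" by linarith
      then show ?thesis
      proof cases
        \<comment> \<open>Index 0 lies outside the index set; both functions are
          \<open>undefined\<close> there.\<close>
        case 1
        then show ?thesis using k by (auto simp: f_def PiE_iff extensional_def)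
      next
        case 2
        then show ?thesis using x kr by (simp add: f_def)
      next
        case 3
        have "x \<in> H n" using x by simp
        then have "x \<in> H (i - 1)" using 3 by (rule_tac memI) auto
        then show ?thesis using 3 n[of i] zero[of x i] by (force simp: f_def)
      qed
    qed
    then have "k = f x" by (simp add: fun_eq_iff)
    then show "k \<in> f ` carrier G" using x(1) by blast
  qed (use fmem in auto)
  moreover have "cyclic_sum_dist a (f x) (f y) = real (LEAST i. inv x \<otimes> y \<in> H i)"
    if "x \<in> carrier G" "y \<in> carrier G" for x y
    using that by (simp add: cyclic_sum_dist_def cyclic_sum_filtration_iff fmem f_eq)
  ultimately show ?thesis using a by blast
qed

section \<open>Comparing the proper metric with the ultrametric\<close>

theorem theorem5p3:
  fixes G :: "('a, 'b) monoid_scheme" and d :: "'a \<Rightarrow> 'a \<Rightarrow> real"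
  assumes "group G"
    and "countable (carrier G)"
    and "locally_finite_group G"
    and "Metric_space (carrier G) d"
    and "left_invariant G d"
    and "proper_metric (carrier G) d"
  shows "\<exists>a :: nat \<Rightarrow> nat. (\<forall>i\<ge>1. a i \<ge> 1) \<and>
    bi_uniformly_equivalent (carrier G) d (carrier (cyclic_sum a)) (cyclic_sum_dist a)"
proof -
  interpret group G by fact
  interpret M: Metric_space "carrier G" d by fact
  \<comment> \<open>Balls are closed, so radius 0 gives only the identity and \<open>H 0\<close> is
    trivial. Properness makes every ball finite, and local finiteness then makes every
    \<open>H n\<close> finite.\<close>
  define ball where "ball r = M.mcball \<one>\<^bsub>G\<^esub> r" for r
  define H where "H n = generate G (ball (real n))" for n
  have ball_iff: "x \<in> ball r \<longleftrightarrow> x \<in> carrier G \<and> d \<one>\<^bsub>G\<^esub> x \<le> r" for x r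
    by (auto simp: ball_def M.in_mcball)
  have fin_ball: "finite (ball r)" for r
    using \<open>proper_metric (carrier G) d\<close> M.mbounded_mcball by (auto simp: ball_def proper_metric_def)
  \<comment> \<open>Translating by the inverse of \<open>x\<close> reduces all estimates to
    distances from the identity.\<close>
  have d_eq: "d x y = d \<one>\<^bsub>G\<^esub> (inv\<^bsub>G\<^esub> x \<otimes>\<^bsub>G\<^esub> y)" if "x \<in> carrier G" "y \<in> carrier G" for x y
    using \<open>left_invariant G d\<close> that unfolding left_invariant_def by (metis inv_closed l_inv)
  have ball_carrier: "ball r \<subseteq> carrier G" for r by (auto simp: ball_iff)
  have sub: "subgroup (H n) G" for n
    unfolding H_def by (rule generate_is_subgroup[OF ball_carrier])
  have finH: "finite (H n)" for n
    using \<open>locally_finite_group G\<close> fin_ball ball_carrier by (auto simp: H_def locally_finite_group_def)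
  have "mono H"
    unfolding H_def by (intro monoI mono_generate) (auto simp: ball_iff)
  have "x \<in> ball (real 0) \<longleftrightarrow> x = \<one>\<^bsub>G\<^esub>" for x
    using M.mdist_pos_eq[OF one_closed, of x] by (auto simp: ball_iff not_less[symmetric])
  then have "ball (real 0) = {\<one>\<^bsub>G\<^esub>}" by auto
  then have H0: "H 0 = {\<one>\<^bsub>G\<^esub>}" unfolding H_def by (simp add: generate_one)
  have ball_H: "x \<in> H n" if "x \<in> ball (real n)" for x n
    using that by (simp add: H_def generate.incl)
  have UH: "(\<Union>n. H n) = carrier G"
  proof
    show "(\<Union>n. H n) \<subseteq> carrier G" using sub subgroup.subset by blast
    show "carrier G \<subseteq> (\<Union>n. H n)"
    proof
      fix x assume "x \<in> carrier G"
      then have "x \<in> ball (real (nat \<lceil>d \<one>\<^bsub>G\<^esub> x\<rceil>))"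
        by (simp add: ball_iff real_nat_ceiling_ge)
      then show "x \<in> (\<Union>n. H n)" using ball_H by blast
    qed
  qed
  obtain a f where a: "\<forall>i\<ge>1. a i \<ge> 1"
    and f: "bij_betw f (carrier G) (carrier (cyclic_sum a))"
    and dist: "\<And>x y. x \<in> carrier G \<Longrightarrow> y \<in> carrier G \<Longrightarrow>
      cyclic_sum_dist a (f x) (f y) = real (LEAST i. inv\<^bsub>G\<^esub> x \<otimes>\<^bsub>G\<^esub> y \<in> H i)"
    using ex_isometry_cyclic_sum[OF sub \<open>mono H\<close> finH H0 UH] by blast
  \<comment> \<open>The least index is attained because the \<open>H i\<close> exhaust the group;
    monotonicity then turns the distance bound into membership.\<close>
  have dist_le: "cyclic_sum_dist a (f x) (f y) \<le> real n \<longleftrightarrow> inv\<^bsub>G\<^esub> x \<otimes>\<^bsub>G\<^esub> y \<in> H n"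
    if x: "x \<in> carrier G" "y \<in> carrier G" for x y n
  proof -
    have "inv\<^bsub>G\<^esub> x \<otimes>\<^bsub>G\<^esub> y \<in> carrier G" using x by simp
    then obtain m where "inv\<^bsub>G\<^esub> x \<otimes>\<^bsub>G\<^esub> y \<in> H m" using UH by blast
    then have "inv\<^bsub>G\<^esub> x \<otimes>\<^bsub>G\<^esub> y \<in> H (LEAST i. inv\<^bsub>G\<^esub> x \<otimes>\<^bsub>G\<^esub> y \<in> H i)" by (rule LeastI)
    then show ?thesis
      using monoD[OF \<open>mono H\<close>, of "LEAST i. inv\<^bsub>G\<^esub> x \<otimes>\<^bsub>G\<^esub> y \<in> H i" n]
      by (auto simp: dist[OF x] intro: Least_le)
  qed
  have eqI: "x = y" if "x \<in> carrier G" "y \<in> carrier G" "inv\<^bsub>G\<^esub> x \<otimes>\<^bsub>G\<^esub> y = \<one>\<^bsub>G\<^esub>" for x y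
    using that d_eq[OF that(1,2)] M.zero by auto
  obtain e where e: "e > 0" "\<And>x. x \<in> carrier G \<Longrightarrow> d \<one>\<^bsub>G\<^esub> x < e \<Longrightarrow> x = \<one>\<^bsub>G\<^esub>"
  proof
    \<comment> \<open>The unit ball is finite, so its nontrivial elements have a least distance from
      the identity. Inserting 1 keeps the set nonempty and forces \<open>e \<le> 1\<close>, so that
      only the unit ball matters.\<close>
    define e where "e = Min (insert 1 (d \<one>\<^bsub>G\<^esub> ` (ball 1 - {\<one>\<^bsub>G\<^esub>})))"
    have fin: "finite (insert 1 (d \<one>\<^bsub>G\<^esub> ` (ball 1 - {\<one>\<^bsub>G\<^esub>})))" using fin_ball by simp
    show "e > 0"
      unfolding e_def using fin by (subst Min_gr_iff) (auto simp: ball_iff M.mdist_pos_eq)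
    fix x assume x: "x \<in> carrier G" "d \<one>\<^bsub>G\<^esub> x < e"
    have "e \<le> 1" using fin by (simp add: e_def)
    then have "x \<in> ball 1" using x by (simp add: ball_iff)
    show "x = \<one>\<^bsub>G\<^esub>"
    proof (rule ccontr)
      assume "x \<noteq> \<one>\<^bsub>G\<^esub>"
      then have "e \<le> d \<one>\<^bsub>G\<^esub> x" unfolding e_def using fin \<open>x \<in> ball 1\<close> by (intro Min_le) auto
      then show False using x by simp
    qed
  qed
  have "uniform_map (carrier G) d (carrier (cyclic_sum a)) (cyclic_sum_dist a) f"
  \<comment> \<open>A quotient at distance at most \<open>n\<close> from the identity lies in the
    generating ball of \<open>H n\<close>, hence the bound \<open>real\<close>.\<close>
  proof (rule uniform_map_of_discrete[where e = e and B = real])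
    show "f \<in> carrier G \<rightarrow> carrier (cyclic_sum a)" using f by (auto simp: bij_betw_def)
    fix x y assume x: "x \<in> carrier G" "y \<in> carrier G"
    show "cyclic_sum_dist a (f x) (f y) \<le> 0" if "d x y < e"
      using e(2)[of "inv\<^bsub>G\<^esub> x \<otimes>\<^bsub>G\<^esub> y"] that x d_eq[OF x] dist_le[OF x, of 0] H0 by simp
    show "cyclic_sum_dist a (f x) (f y) \<le> real n" if "d x y \<le> real n" for n
      using that x d_eq[OF x] by (simp add: dist_le ball_H ball_iff)
  qed (fact e)
  moreover have "uniform_map (carrier (cyclic_sum a)) (cyclic_sum_dist a) (carrier G) d
      (inv_into (carrier G) f)"
  \<comment> \<open>The ultrametric takes integer values, so a distance below 1 is 0. The bound at
    scale \<open>n\<close> is the largest \<open>d\<close>-distance from the identity within the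
    finite set \<open>H n\<close>.\<close>
  proof (rule uniform_map_of_discrete[where e = 1 and B = "\<lambda>n. Max (d \<one>\<^bsub>G\<^esub> ` H n)"])
    let ?g = "inv_into (carrier G) f"
    have g: "?g u \<in> carrier G" "f (?g u) = u" if "u \<in> carrier (cyclic_sum a)" for u
      using f that by (auto simp: bij_betw_def inv_into_into f_inv_into_f)
    show "?g \<in> carrier (cyclic_sum a) \<rightarrow> carrier G" using g by auto
    fix u v assume u: "u \<in> carrier (cyclic_sum a)" "v \<in> carrier (cyclic_sum a)"
    let ?z = "inv\<^bsub>G\<^esub> ?g u \<otimes>\<^bsub>G\<^esub> ?g v"
    have le: "cyclic_sum_dist a u v \<le> real n \<longleftrightarrow> ?z \<in> H n" for n
      using dist_le[of "?g u" "?g v" n] g u by simp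
    show "d (?g u) (?g v) \<le> Max (d \<one>\<^bsub>G\<^esub> ` H n)" if "cyclic_sum_dist a u v \<le> real n" for n
      using that d_eq[of "?g u" "?g v"] g u finH by (auto simp: le)
    show "d (?g u) (?g v) \<le> 0" if "cyclic_sum_dist a u v < 1"
    proof -
      have "cyclic_sum_dist a u v \<le> real 0"
        using that by (simp add: cyclic_sum_dist_def)
      then have "?z = \<one>\<^bsub>G\<^esub>" using le[of 0] H0 by blast
      then have "?g u = ?g v" by (rule eqI[OF g(1)[OF u(1)] g(1)[OF u(2)]])
      then show ?thesis using g(1)[OF u(2)] by simp
    qed
  qed simp
  ultimately show ?thesis
    using a f unfolding bi_uniformly_equivalent_def by blast
qed

end
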